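(* Let $m,n\ge 2$ be integers and let $LP_{n,m}$ be a long brush graph which is $2$-distance magic with $2$-distance magic labeling $f$. Then: (i) if the induced subgraph $\langle v_1,\dots,v_m\rangle$ is the complete graph $K_m$, then $m(m-1)\le 2n$; (ii) if $\langle v_1,\dots,v_m\rangle\neq K_m$, then for all $v_i,v_j$ with $d(v_i,v_j)=2$, $1\le i<j\le m$, $$\sum_{w\in N[v_i]} f(w)=\sum_{w\in N[v_j]} f(w),$$ where $N[v]$ denotes the closed neighbourhood of $v$ in $LP_{n,m}$.
   Context: All graphs are finite, simple and undirected; $d(u,v)$ is graph distance. For $u\in V(G)$ and $k\in\mathbb{N}$, $\partial N_k(u)=\{v\in V(G): d(u,v)=k\}$. For a graph $G$ of order $p\ge3$, a $k$-distance magic labeling is a bijection $f:V(G)\to\{1,\dots,p\}$ together with a constant $M$ such that $\sum_{w\in\partial N_k(u)} f(w)=M$ for every vertex $u$ with $\partial N_k(u)\neq\emptyset$ (and $G$ has at least one pair of vertices at distance $k$). $G$ is $k$-distance magic if it has such a labeling. A long brush $LP_{n,m}$ ($m,n\in\mathbb{N}$, $m+n\ge3$) has vertex set $\{u_1,\dots,u_n,v_1,\dots,v_m\}$, with edges $u_iu_{i+1}$ ($1\le i<n$), $u_1v_i$ ($1\le i\le m$), and an arbitrary set of edges among $v_1,\dots,v_m$; $\langle v_1,\dots,v_m\rangle$ denotes the induced subgraph on $\{v_1,\dots,v_m\}$. *)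

theory Defs
  imports "Graph_Theory.Graph_Theory"
begin

text \<open>
  Finite simple undirected graphs are the models of the locale \<^locale>\<open>graph\<close>
  (symmetric loop-free digraphs without parallel arcs). An undirected edge $uv$ is
  the pair of arcs $u \to v$ and $v \to u$, and $u$, $v$ are adjacent iff one
  dominates the other.
\<close>

text \<open>Length of a shortest walk; the value is infinite if there is no walk.\<close>

definition graph_dist :: "('a, 'b) pre_digraph \<Rightarrow> 'a \<Rightarrow> 'a \<Rightarrow> ereal" where
  "graph_dist G x y = wf_digraph.\<mu> G (\<lambda>_. 1) x y"

definition boundary_nbhd :: "('a, 'b) pre_digraph \<Rightarrow> nat \<Rightarrow> 'a \<Rightarrow> 'a set" where
  "boundary_nbhd G k x = {y \<in> verts G. graph_dist G x y = ereal (real k)}"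

definition closed_nbhd :: "('a, 'b) pre_digraph \<Rightarrow> 'a \<Rightarrow> 'a set" where
  "closed_nbhd G x = insert x {y \<in> verts G. x \<rightarrow>\<^bsub>G\<^esub> y}"

definition distance_magic_labeling ::
    "('a, 'b) pre_digraph \<Rightarrow> nat \<Rightarrow> ('a \<Rightarrow> nat) \<Rightarrow> bool" where
  "distance_magic_labeling G k f \<longleftrightarrow>
     graph G \<and> card (verts G) \<ge> 3 \<and>
     bij_betw f (verts G) {1..card (verts G)} \<and>
     (\<exists>x\<in>verts G. \<exists>y\<in>verts G. graph_dist G x y = ereal (real k)) \<and>
     (\<exists>M::nat. \<forall>x\<in>verts G.
        boundary_nbhd G k x \<noteq> {} \<longrightarrow> (\<Sum>y\<in>boundary_nbhd G k x. f y) = M)"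

text \<open>
  \<open>long_brush G n m u v\<close>: the graph \<open>G\<close>, with its vertices enumerated as
  \<open>u 1, \<dots>, u n, v 1, \<dots>, v m\<close>, is a long brush $LP_{n,m}$.
  Values of \<open>u\<close> and \<open>v\<close> outside these index ranges are irrelevant, and
  adjacency among the \<open>v j\<close> is left unconstrained.
\<close>

definition long_brush ::
    "('a, 'b) pre_digraph \<Rightarrow> nat \<Rightarrow> nat \<Rightarrow> (nat \<Rightarrow> 'a) \<Rightarrow> (nat \<Rightarrow> 'a) \<Rightarrow> bool" where
  "long_brush G n m u v \<longleftrightarrow>
     graph G \<and> n \<ge> 1 \<and> m \<ge> 1 \<and> m + n \<ge> 3 \<and>
     inj_on u {1..n} \<and> inj_on v {1..m} \<and> u ` {1..n} \<inter> v ` {1..m} = {} \<and>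
     verts G = u ` {1..n} \<union> v ` {1..m} \<and>
     (\<forall>i\<in>{1..n}. \<forall>j\<in>{1..n}. u i \<rightarrow>\<^bsub>G\<^esub> u j \<longleftrightarrow> j = i + 1 \<or> i = j + 1) \<and>
     (\<forall>i\<in>{1..n}. \<forall>j\<in>{1..m}. u i \<rightarrow>\<^bsub>G\<^esub> v j \<longleftrightarrow> i = 1)"

end

theory Submission
  imports Defs
begin

text \<open>
  Every \<open>v i\<close> lies at distance at most 2 from exactly the vertices
  \<open>u 1\<close>, \<open>u 2\<close>, \<open>v 1, \<dots>, v m\<close>, and this set is the disjoint union of the closed
  neighbourhood of \<open>v i\<close> and its 2-boundary. The latter contains \<open>u 2\<close>, so it has
  the magic constant \<open>M\<close> as weight; hence all the closed neighbourhoods of the \<open>v i\<close> have the same weight.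
  If the \<open>v i\<close> form a clique, the 2-boundary of \<open>v 1\<close> is \<open>{u 2}\<close>, so
  \<open>M = f (u 2) \<le> n + m\<close>, while the 2-boundary of \<open>u 2\<close> contains all the \<open>v i\<close>, so
  \<open>M \<ge> 1 + \<dots> + m\<close>.
\<close>

section \<open>Distance 2 in terms of adjacency\<close>

context wf_digraph
begin

lemma awalk_cost_one: "awalk_cost (\<lambda>_. 1) p = real (length p)"
  by (induction p) auto

text \<open>The distance is an infimum of walk costs in \<open>ereal\<close>. It is attained because
  lengths are integers: an infimum of value \<open>k\<close> lies strictly below
  \<open>Suc k\<close>, so some walk is shorter than \<open>Suc k\<close>, and no walk is shorter
  than \<open>k\<close>.\<close>

lemma graph_dist_eq_iff:
  "graph_dist G x y = ereal (real k) \<longleftrightarrow>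
    (\<exists>p. awalk x p y \<and> length p = k) \<and> (\<forall>p. awalk x p y \<longrightarrow> k \<le> length p)"
proof
  assume L: "graph_dist G x y = ereal (real k)"
  have lower: "k \<le> length p" if "awalk x p y" for p
    using min_cost_le_walk_cost[OF that, of "\<lambda>_. 1"] L
    by (simp add: graph_dist_def awalk_cost_one)
  have "graph_dist G x y < ereal (real (Suc k))"
    by (simp add: L)
  then obtain p where "awalk x p y" "length p < Suc k"
    by (auto simp: graph_dist_def \<mu>_def INF_less_iff awalk_cost_one)
  with lower show "(\<exists>p. awalk x p y \<and> length p = k) \<and> (\<forall>p. awalk x p y \<longrightarrow> k \<le> length p)"
    by (metis le_antisym less_Suc_eq_le)
next
  assume R: "(\<exists>p. awalk x p y \<and> length p = k) \<and> (\<forall>p. awalk x p y \<longrightarrow> k \<le> length p)"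
  then obtain p where p: "awalk x p y" "length p = k"
    by blast
  show "graph_dist G x y = ereal (real k)"
    unfolding graph_dist_def
  proof (rule antisym)
    show "\<mu> (\<lambda>_. 1) x y \<le> ereal (real k)"
      using min_cost_le_walk_cost[OF p(1), of "\<lambda>_. 1"] p(2) by (simp add: awalk_cost_one)
    show "ereal (real k) \<le> \<mu> (\<lambda>_. 1) x y"
      unfolding \<mu>_def using R by (auto intro!: INF_greatest simp: awalk_cost_one)
  qed
qed

lemma awalk_Nil_ends: "awalk x [] y \<longleftrightarrow> x \<in> verts G \<and> x = y"
  by (auto simp: awalk_Nil_iff)

lemma ex_awalk_one: "(\<exists>e. awalk x [e] y) \<longleftrightarrow> x \<rightarrow>\<^bsub>G\<^esub> y"
  by (auto simp: awalk_simps arcs_ends_def arc_to_ends_def image_iff)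

lemma ex_awalk_two: "(\<exists>e e'. awalk x [e, e'] y) \<longleftrightarrow> (\<exists>z. x \<rightarrow>\<^bsub>G\<^esub> z \<and> z \<rightarrow>\<^bsub>G\<^esub> y)"
  by (fastforce simp: awalk_simps arcs_ends_def arc_to_ends_def image_iff)

text \<open>Minimality of 2 only rules out walks of length 0 and 1, which amount to equality and
  adjacency. Later arguments can thus work with common neighbours instead of walks.\<close>

lemma boundary_nbhd_2:
  assumes "x \<in> verts G"
  shows "boundary_nbhd G 2 x =
    {y \<in> verts G. y \<noteq> x \<and> \<not> x \<rightarrow>\<^bsub>G\<^esub> y \<and> (\<exists>z. x \<rightarrow>\<^bsub>G\<^esub> z \<and> z \<rightarrow>\<^bsub>G\<^esub> y)}"
proof -
  have two: "(\<exists>p. awalk x p y \<and> length p = 2) \<longleftrightarrow> (\<exists>e e'. awalk x [e, e'] y)" for y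
    by (auto simp: numeral_2_eq_2 length_Suc_conv)
  have "(\<forall>p. awalk x p y \<longrightarrow> 2 \<le> length p) \<longleftrightarrow>
      \<not> awalk x [] y \<and> \<not> (\<exists>e. awalk x [e] y)" for y
  proof -
    have "length p < 2 \<longleftrightarrow> p = [] \<or> (\<exists>e. p = [e])" for p :: "'b list"
      by (cases p) (auto simp: less_Suc_eq numeral_2_eq_2)
    then show ?thesis
      by (metis linorder_not_le)
  qed
  then show ?thesis
    unfolding boundary_nbhd_def graph_dist_eq_iff two ex_awalk_one ex_awalk_two
    using assms by (auto simp: awalk_Nil_ends)
qed

end

text \<open>Induction on the maximum \<open>b\<close>: the other elements are positive and below
  \<open>b\<close>, so \<open>b\<close> is at least \<open>card S + 1\<close>, the increment of the
  triangular number.\<close>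

lemma sum_ge_triangular:
  assumes "finite S" "0 \<notin> S"
  shows "card S * (card S + 1) \<le> 2 * \<Sum>(S :: nat set)"
  using assms
proof (induction S rule: finite_linorder_max_induct)
  case (insert b S)
  have "S \<subseteq> {1..<b}"
    using insert.hyps insert.prems by (auto simp: Suc_le_eq intro: gr0I)
  then have "card S \<le> card {1..<b}"
    by (intro card_mono) auto
  moreover have "0 < b"
    using insert.prems by auto
  ultimately have "card S + 1 \<le> b"
    by simp
  moreover have "b \<notin> S"
    using insert.hyps by auto
  ultimately show ?case
    using insert by (simp add: algebra_simps)
qed simp

section \<open>Neighbourhoods and 2-boundaries in a long brush\<close>

context
  fixes G :: "('a, 'b) pre_digraph" and n m :: nat and u v :: "nat \<Rightarrow> 'a"
  assumes n2: "2 \<le> n" and brush: "long_brush G n m u v"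
begin

interpretation graph G
  using brush by (simp add: long_brush_def)

lemma long_brush_verts: "verts G = u ` {1..n} \<union> v ` {1..m}"
  using brush by (simp add: long_brush_def)

lemma long_brush_u_ne_v: "i \<in> {1..n} \<Longrightarrow> j \<in> {1..m} \<Longrightarrow> u i \<noteq> v j"
  using brush by (fastforce simp: long_brush_def)

lemma long_brush_uu: "i \<in> {1..n} \<Longrightarrow> j \<in> {1..n} \<Longrightarrow> u i \<rightarrow>\<^bsub>G\<^esub> u j \<longleftrightarrow> j = i + 1 \<or> i = j + 1"
  using brush by (simp add: long_brush_def)

lemma long_brush_uv: "i \<in> {1..n} \<Longrightarrow> j \<in> {1..m} \<Longrightarrow> u i \<rightarrow>\<^bsub>G\<^esub> v j \<longleftrightarrow> i = 1"
  using brush by (simp add: long_brush_def)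

lemma adj_sym: "x \<rightarrow>\<^bsub>G\<^esub> y \<longleftrightarrow> y \<rightarrow>\<^bsub>G\<^esub> x"
  using graph_symmetric by blast

lemma long_brush_vu: "i \<in> {1..n} \<Longrightarrow> j \<in> {1..m} \<Longrightarrow> v j \<rightarrow>\<^bsub>G\<^esub> u i \<longleftrightarrow> i = 1"
  using long_brush_uv adj_sym by blast

lemma boundary_nbhd_v:
  assumes i: "i \<in> {1..m}"
  shows "boundary_nbhd G 2 (v i) = insert (u 2) {y \<in> v ` {1..m}. y \<noteq> v i \<and> \<not> v i \<rightarrow>\<^bsub>G\<^esub> y}"
    (is "_ = ?B")
proof -
  have vi: "v i \<in> verts G"
    using i by (simp add: long_brush_verts)
  have v_u1: "v i \<rightarrow>\<^bsub>G\<^esub> u 1"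
    using i n2 by (simp add: long_brush_vu)
  have sub: "y \<in> ?B" if y: "y \<in> verts G" "y \<noteq> v i" "\<not> v i \<rightarrow>\<^bsub>G\<^esub> y" "v i \<rightarrow>\<^bsub>G\<^esub> z" "z \<rightarrow>\<^bsub>G\<^esub> y" for y z
  proof (cases "y \<in> v ` {1..m}")
    case False
    then obtain k where k: "k \<in> {1..n}" "y = u k"
      using y(1) by (auto simp: long_brush_verts)
    then have "k \<noteq> 1"
      using v_u1 y(3) by auto
    \<comment> \<open>The middle vertex \<open>z\<close> is \<open>u 1\<close> or some
      \<open>v j\<close>. A neighbour \<open>u k\<close> of \<open>v j\<close> would have
      \<open>k = 1\<close>, which is excluded, so \<open>z\<close> is \<open>u 1\<close> and
      \<open>k = 2\<close>.\<close>
    have "z \<in> verts G"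
      using y(4) by (rule adj_in_verts)
    then consider "z = u 1" | j where "j \<in> {1..m}" "z = v j"
      using y(4) i by (auto simp: long_brush_verts long_brush_vu)
    then have "k = 2"
      using y(5) k n2 \<open>k \<noteq> 1\<close> by cases (auto simp: long_brush_uu long_brush_vu)
    with k show ?thesis by simp
  qed (use y in auto)
  have u2: "u 2 \<noteq> v i" "\<not> v i \<rightarrow>\<^bsub>G\<^esub> u 2" "u 1 \<rightarrow>\<^bsub>G\<^esub> u 2" "u 2 \<in> verts G"
    using i n2 by (auto simp: long_brush_u_ne_v long_brush_vu long_brush_uu long_brush_verts)
  have v: "u 1 \<rightarrow>\<^bsub>G\<^esub> y" "y \<in> verts G" if "y \<in> v ` {1..m}" for y
    using that n2 by (auto simp: long_brush_uv long_brush_verts)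
  show ?thesis
    unfolding boundary_nbhd_2[OF vi]
  proof (intro subset_antisym subsetI CollectI)
    fix y
    assume "y \<in> ?B"
    then consider "y = u 2" | "y \<in> v ` {1..m}" "y \<noteq> v i" "\<not> v i \<rightarrow>\<^bsub>G\<^esub> y"
      by auto
    \<comment> \<open>The single vertex \<open>u 1\<close> serves as the common neighbour for every
      \<open>y\<close>.\<close>
    then have "y \<in> verts G \<and> y \<noteq> v i \<and> \<not> v i \<rightarrow>\<^bsub>G\<^esub> y \<and> u 1 \<rightarrow>\<^bsub>G\<^esub> y"
      using u2 v by cases auto
    with v_u1 show "y \<in> verts G \<and> y \<noteq> v i \<and> \<not> v i \<rightarrow>\<^bsub>G\<^esub> y \<and>
        (\<exists>z. v i \<rightarrow>\<^bsub>G\<^esub> z \<and> z \<rightarrow>\<^bsub>G\<^esub> y)"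
      by blast
  qed (elim CollectE conjE exE, rule sub)
qed

lemma closed_nbhd_v:
  assumes i: "i \<in> {1..m}"
  shows "closed_nbhd G (v i) = insert (u 1) {y \<in> v ` {1..m}. y = v i \<or> v i \<rightarrow>\<^bsub>G\<^esub> y}"
  using i n2 unfolding closed_nbhd_def long_brush_verts
  by (auto simp: long_brush_vu)

text \<open>Each \<open>v j\<close> falls into exactly one of the two sets; \<open>u 1\<close> is
  always in the first and \<open>u 2\<close> in the second. The total is therefore independent of
  \<open>i\<close>.\<close>

lemma closed_nbhd_plus_boundary_nbhd:
  fixes f :: "'a \<Rightarrow> nat"
  assumes i: "i \<in> {1..m}"
  shows "sum f (closed_nbhd G (v i)) + sum f (boundary_nbhd G 2 (v i)) =
    f (u 1) + f (u 2) + sum f (v ` {1..m})"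
proof -
  let ?N = "{y \<in> v ` {1..m}. y = v i \<or> v i \<rightarrow>\<^bsub>G\<^esub> y}"
  let ?B = "{y \<in> v ` {1..m}. y \<noteq> v i \<and> \<not> v i \<rightarrow>\<^bsub>G\<^esub> y}"
  have u: "u 1 \<notin> v ` {1..m}" "u 2 \<notin> v ` {1..m}"
    using n2 long_brush_u_ne_v by auto
  have "sum f (v ` {1..m}) = sum f ?N + sum f ?B"
    by (subst sum.union_disjoint[symmetric]) (auto intro!: arg_cong[of _ _ "sum f"])
  moreover have "sum f (insert (u 1) ?N) = f (u 1) + sum f ?N"
    using u by (intro sum.insert) auto
  moreover have "sum f (insert (u 2) ?B) = f (u 2) + sum f ?B"
    using u by (intro sum.insert) auto
  ultimately show ?thesis
    unfolding closed_nbhd_v[OF i] boundary_nbhd_v[OF i] by simp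
qed

lemma v_subset_boundary_nbhd_u2: "v ` {1..m} \<subseteq> boundary_nbhd G 2 (u 2)"
proof -
  have u2: "u 2 \<in> verts G" "u 2 \<rightarrow>\<^bsub>G\<^esub> u 1"
    using n2 by (auto simp: long_brush_verts long_brush_uu)
  show ?thesis
    unfolding boundary_nbhd_2[OF u2(1)]
  proof (intro image_subsetI CollectI conjI)
    fix j assume j: "j \<in> {1..m}"
    show "v j \<in> verts G" "v j \<noteq> u 2" "\<not> u 2 \<rightarrow>\<^bsub>G\<^esub> v j"
      using j n2 long_brush_u_ne_v[of 2 j] by (auto simp: long_brush_uv long_brush_verts)
    show "\<exists>z. u 2 \<rightarrow>\<^bsub>G\<^esub> z \<and> z \<rightarrow>\<^bsub>G\<^esub> v j"
      using u2(2) j n2 by (intro exI[of _ "u 1"]) (simp add: long_brush_uv)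
  qed
qed

end

theorem theorem3p2:
  fixes G :: "('a, 'b) pre_digraph" and n m :: nat
    and u v :: "nat \<Rightarrow> 'a" and f :: "'a \<Rightarrow> nat"
  assumes "m \<ge> 2" and "n \<ge> 2"
    and "long_brush G n m u v"
    and "distance_magic_labeling G 2 f"
  shows "(complete_digraph m (G \<restriction> v ` {1..m}) \<longrightarrow> m * (m - 1) \<le> 2 * n) \<and>
    (\<not> complete_digraph m (G \<restriction> v ` {1..m}) \<longrightarrow>
      (\<forall>i j. 1 \<le> i \<and> i < j \<and> j \<le> m \<and> graph_dist G (v i) (v j) = 2 \<longrightarrow>
        (\<Sum>w\<in>closed_nbhd G (v i). f w) = (\<Sum>w\<in>closed_nbhd G (v j). f w)))"
proof -
  note brush = assms(2,3)
  let ?V = "v ` {1..m}"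
  obtain M where M: "\<And>x. x \<in> verts G \<Longrightarrow> boundary_nbhd G 2 x \<noteq> {} \<Longrightarrow>
      sum f (boundary_nbhd G 2 x) = M"
    using assms(4) unfolding distance_magic_labeling_def by blast
  have bij: "bij_betw f (verts G) {1..card (verts G)}"
    using assms(4) by (simp add: distance_magic_labeling_def)
  have verts: "verts G = u ` {1..n} \<union> ?V" "inj_on u {1..n}" "inj_on v {1..m}"
      "u ` {1..n} \<inter> ?V = {}"
    using assms(3) by (auto simp: long_brush_def)
  have card_V: "card ?V = m"
    using verts(3) by (simp add: card_image)
  have card_G: "card (verts G) = n + m"
    using verts by (simp add: card_Un_disjoint card_image)
  have M_v: "sum f (boundary_nbhd G 2 (v i)) = M" if "i \<in> {1..m}" for i
    using that by (intro M) (auto simp: verts(1) boundary_nbhd_v[OF brush])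
  \<comment> \<open>Both identities have the same right-hand side, and the boundary weight
    \<open>M\<close> cancels.\<close>
  have closed: "sum f (closed_nbhd G (v i)) = sum f (closed_nbhd G (v j))"
    if "i \<in> {1..m}" "j \<in> {1..m}" for i j
    using closed_nbhd_plus_boundary_nbhd[OF brush that(1), of f]
      closed_nbhd_plus_boundary_nbhd[OF brush that(2), of f] M_v that by simp
  have bound: "m * (m - 1) \<le> 2 * n" if K: "complete_digraph m (G \<restriction> ?V)"
  proof -
    have "v 1 \<rightarrow>\<^bsub>G\<^esub> y" if "y \<in> ?V" "y \<noteq> v 1" for y
    proof -
      \<comment> \<open>Completeness speaks of the induced subgraph, whose arcs are carried over to
        \<open>G\<close>.\<close>
      have "(v 1, y) \<in> arcs_ends (G \<restriction> ?V)"
        using K that assms(1) by (auto simp: complete_digraph_def)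
      then show ?thesis
        by (rule dominates_induce_subgraphD)
    qed
    then have "boundary_nbhd G 2 (v 1) = {u 2}"
      using assms(1) by (subst boundary_nbhd_v[OF brush]) auto
    then have "M = f (u 2)"
      using M_v[of 1] assms(1) by simp
    moreover have u2: "u 2 \<in> verts G"
      using assms(2) verts(1) by auto
    ultimately have "M \<le> n + m"
      using bij_betwE[OF bij] card_G by auto
    moreover have "sum f ?V \<le> M"
    proof -
      have sub: "?V \<subseteq> boundary_nbhd G 2 (u 2)"
        by (rule v_subset_boundary_nbhd_u2[OF brush])
      have "finite (boundary_nbhd G 2 (u 2))"
        by (rule finite_subset[of _ "verts G"]) (auto simp: boundary_nbhd_def verts(1))
      then have "sum f ?V \<le> sum f (boundary_nbhd G 2 (u 2))"
        using sub by (rule sum_mono2) simp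
      \<comment> \<open>The magic condition applies because the boundary contains the nonempty set
        \<open>?V\<close>.\<close>
      also have "\<dots> = M"
        using u2 sub assms(1) by (intro M) auto
      finally show ?thesis .
    qed
    moreover have "m * (m + 1) \<le> 2 * sum f ?V"
    proof -
      have inj: "inj_on f ?V"
        using bij by (auto simp: bij_betw_def verts(1) inj_on_Un)
      \<comment> \<open>Labels start at 1, so \<open>?V\<close> carries \<open>m\<close> distinct
        positive integers.\<close>
      have "0 \<notin> f ` ?V"
        using bij_betwE[OF bij] by (force simp: verts(1))
      then show ?thesis
        using sum_ge_triangular[of "f ` ?V"] inj card_V
        by (simp add: card_image sum.reindex)
    qed
    ultimately have "m * (m + 1) \<le> 2 * (n + m)"
      by (meson mult_le_mono2 order_trans)
    \<comment> \<open>This form lets \<open>2 * m\<close> cancel on both sides; the case split deals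
      with truncated subtraction.\<close>
    moreover have "m * (m + 1) = m * (m - 1) + 2 * m"
      by (cases m) (auto simp: algebra_simps)
    ultimately show ?thesis
      by simp
  qed
  show ?thesis
    by (intro conjI impI allI bound closed) simp_all
qed

end
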